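(* Let $\alpha$ be an ordinal. If $x=(A,B)\in\overline{\mathbb{R}}_\alpha$ is a proper Dedekind cut with $x\neq 0$, then $\frac{1}{x}$ is a proper Dedekind cut and $x\cdot\frac1x=1$.
   Context: For an ordinal $\alpha$, let $\mathbb{N}_\alpha$ be the set of ordinals strictly less than $\omega^{\omega^\alpha}$ with the ordinal order and the natural (Hessenberg) sum and product. Let $\mathbb{Z}_\alpha$ be the classes of pairs $(a,b)\in\mathbb{N}_\alpha^2$ under $(a,b)\sim(c,d)\iff a+d=b+c$, with $(a,b)+(c,d)=(a+c,b+d)$, $(a,b)(c,d)=(ac+bd,ad+bc)$, order $[(a_1,a_2)]\ge[(b_1,b_2)]\iff a_1+b_2\ge a_2+b_1$. Let $\mathbb{Q}_\alpha$ be its field of fractions (classes of $(a,b)$, $b\ne0$, under $ad=bc$, usual fraction operations), a linearly ordered field with $A\ge0$ iff $ab\ge0$ for representatives and $A\ge B$ iff $A-B\ge0$; $\mathbb{Q}_\alpha^+$ and $\mathbb{Q}_\alpha^{\le 0}$ denote its positive and nonpositive elements. A Dedekind cut on $\mathbb{Q}_\alpha$ is a pair $(A,B)$ of subsets such that: every element of $A$ is less than every element of $B$; $\mathbb{Q}_\alpha\setminus(A\cup B)$ has at most one element; $\inf(B)\notin B$ and $\sup(A)\notin A$; $A\cap B=\varnothing$. $\overline{\mathbb{R}}_\alpha$ is the set of all such cuts, ordered by $(A_1,B_1)\ge(A_2,B_2)\iff A_2\subseteq A_1$. A ball in $\mathbb{Q}_\alpha$ is $\{y:|x-y|<r\}$,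 $x\in\mathbb{Q}_\alpha$, $r\in\mathbb{Q}_\alpha^+$; a cut $(A,B)$ is improper if there is $d\in\mathbb{Q}_\alpha^+$ such that every ball $U$ meeting both $A$ and $B$ has $\sup(U)-\inf(U)>d$, otherwise proper. Zero cut $0=(\{q<0\},\{q>0\})$, unit cut $1=(\{q<1\},\{q>1\})$. Opposite: $-(A,B)=(\{-y:y\in B\},\{-y:y\in A\})$; $|x|=x$ if $x\ge0$, $|x|=-x$ if $x<0$. Product of positive cuts: $(A,B)\cdot(C,D)=(A\cdot C,B\cdot D)$ with $X\cdot Y=\{xy:x\in X,y\in Y\}$; for general cuts, with $(E,F)=|(A,B)|\cdot|(C,D)|$, the product is $(E,F)$ if the two cuts have the same sign and $-(E,F)$ otherwise. Inverse: if $(A,B)>0$, then $\frac{1}{(A,B)}=(C,D)$ with $C=\{1/y: y\in B\}\cup\mathbb{Q}_\alpha^{\le0}$ and $D=\mathbb{Q}_\alpha\setminus(C\cup\{\sup C\})$; if $(A,B)<0$, then $\frac1{(A,B)}=-\frac{1}{|(A,B)|}$.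
   Formalization: In a Dedekind cut, an element of ℚ_α outside A∪B is also required to lie above A and below B; in the product of positive cuts the lower set is the negative elements together with products xy of nonnegative x∈A, y∈C. Read literally, the statement is false. *)

theory Defs
  imports
    "HOL-Library.Poly_Mapping"
    "HOL-Library.Lub_Glb"
    "HOL-Computational_Algebra.Fraction_Field"
begin

section \<open>Ordinals\<close>

text \<open>
  Ordinals are the order-isomorphism classes of the well-orders on subsets of \<open>'b\<close>. As \<open>'b\<close> is
  arbitrary, every order type that exists in HOL is covered; the least element is the ordinal 0.
\<close>

quotient_type 'b ordinal = "'b rel" / partial: "\<lambda>r s. (r, s) \<in> ordIso"
proof (rule part_equivpI)
  have "Well_order ({} :: 'b rel)" by simp
  then show "\<exists>r::'b rel. (r, r) \<in> ordIso" using ordIso_reflexive by blast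
  show "symp (\<lambda>r s::'b rel. (r, s) \<in> ordIso)" by (auto intro: sympI ordIso_symmetric)
  show "transp (\<lambda>r s::'b rel. (r, s) \<in> ordIso)" by (auto intro: transpI ordIso_transitive)
qed

lemma ordIso_Well_order: "(r, s) \<in> ordIso \<Longrightarrow> Well_order r" "(r, s) \<in> ordIso \<Longrightarrow> Well_order s"
  by (auto simp: ordIso_def)

instantiation ordinal :: (type) wellorder
begin

lift_definition less_eq_ordinal :: "'a ordinal \<Rightarrow> 'a ordinal \<Rightarrow> bool" is "\<lambda>r s. (r, s) \<in> ordLeq"
  by (meson ordIso_ordLeq_trans ordLeq_ordIso_trans ordIso_symmetric)

definition less_ordinal :: "'a ordinal \<Rightarrow> 'a ordinal \<Rightarrow> bool" where
  "less_ordinal x y \<longleftrightarrow> x \<le> y \<and> \<not> y \<le> x"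

instance
proof
  fix x y z :: "'a ordinal"
  show "(x < y) = (x \<le> y \<and> \<not> y \<le> x)" by (rule less_ordinal_def)
  show "x \<le> x" by transfer (simp add: ordIso_iff_ordLeq)
  show "x \<le> y \<Longrightarrow> y \<le> z \<Longrightarrow> x \<le> z" by transfer (rule ordLeq_transitive)
  show "x \<le> y \<Longrightarrow> y \<le> x \<Longrightarrow> x = y" by transfer (simp add: ordIso_iff_ordLeq)
  show "x \<le> y \<or> y \<le> x" by transfer (rule ordLeq_total; rule ordIso_Well_order)
next
  fix P :: "'a ordinal \<Rightarrow> bool" and a
  assume step: "\<And>x. (\<And>y. y < x \<Longrightarrow> P y) \<Longrightarrow> P x"
  have "(rep_ordinal x, rep_ordinal y) \<in> ordLess" if "x < y" for x y :: "'a ordinal"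
  proof -
    have W: "Well_order (rep_ordinal z)" for z :: "'a ordinal"
      using Quotient_rep_reflp[OF Quotient_ordinal, of z] ordIso_Well_order by blast
    have "x \<le> y \<longleftrightarrow> (rep_ordinal x, rep_ordinal y) \<in> ordLeq" for x y :: "'a ordinal"
      by (simp add: less_eq_ordinal_def)
    with that W show ?thesis
      by (meson less_ordinal_def not_ordLeq_iff_ordLess)
  qed
  then have "{(x, y::'a ordinal). x < y} \<subseteq> inv_image ordLess rep_ordinal"
    by (auto simp: inv_image_def)
  then have "wf {(x, y::'a ordinal). x < y}"
    by (rule wf_subset[OF wf_inv_image[OF wf_ordLess]])
  then show "P a"
    by (induction a rule: wf_induct_rule) (use step in auto)
qed

end


section \<open>Ordinal powers of \<open>\<omega>\<close> and Hessenberg arithmetic\<close>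

text \<open>
  If the well-ordered type \<open>'w\<close> has order type \<open>\<theta>\<close>, then \<open>'w omega_pow\<close> consists of the ordinals below
  \<open>\<omega> ^ \<theta>\<close>: the ordinal with Cantor normal form \<open>\<omega> ^ x\<^sub>1 * n\<^sub>1 + \<dots> + \<omega> ^ x\<^sub>k * n\<^sub>k\<close> is represented by the
  finitely supported coefficient function \<open>x\<^sub>i \<mapsto> n\<^sub>i\<close>, and two ordinals are compared at the largest
  exponent at which their normal forms differ. A type copy is needed because the order of the
  library on \<open>\<Rightarrow>\<^sub>0\<close> compares at the smallest key.
\<close>

typedef 'w omega_pow = "UNIV :: ('w \<Rightarrow>\<^sub>0 nat) set"
  morphisms cnf Abs_omega_pow by simp

setup_lifting type_definition_omega_pow

lift_definition cnf_coeff :: "'w omega_pow \<Rightarrow> 'w \<Rightarrow> nat" is Poly_Mapping.lookup .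

lift_definition omega_exp :: "'w \<Rightarrow> 'w omega_pow" is "\<lambda>x. Poly_Mapping.single x 1" .

lemma omega_pow_eqI: "(\<And>x. cnf_coeff f x = cnf_coeff g x) \<Longrightarrow> f = g"
  by transfer (rule poly_mapping_eqI)

lemma finite_cnf_coeff: "finite {x. cnf_coeff f x \<noteq> 0}"
  by transfer simp

instantiation omega_pow :: (linorder) linorder
begin

definition less_omega_pow :: "'a omega_pow \<Rightarrow> 'a omega_pow \<Rightarrow> bool" where
  "f < g \<longleftrightarrow> (\<exists>x. cnf_coeff f x < cnf_coeff g x \<and> (\<forall>y>x. cnf_coeff f y = cnf_coeff g y))"

definition less_eq_omega_pow :: "'a omega_pow \<Rightarrow> 'a omega_pow \<Rightarrow> bool" where
  "f \<le> g \<longleftrightarrow> f < g \<or> f = (g :: 'a omega_pow)"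

lemma omega_pow_neqE:
  fixes f g :: "'a omega_pow"
  assumes "f \<noteq> g"
  obtains x where "cnf_coeff f x \<noteq> cnf_coeff g x" "\<And>y. y > x \<Longrightarrow> cnf_coeff f y = cnf_coeff g y"
proof -
  let ?D = "{x. cnf_coeff f x \<noteq> cnf_coeff g x}"
  have "?D \<subseteq> {x. cnf_coeff f x \<noteq> 0} \<union> {x. cnf_coeff g x \<noteq> 0}" by auto
  then have fin: "finite ?D" by (rule finite_subset) (intro finite_UnI finite_cnf_coeff)
  have ne: "?D \<noteq> {}" using assms omega_pow_eqI[of f g] by auto
  show ?thesis
  proof (rule that[of "Max ?D"])
    show "cnf_coeff f (Max ?D) \<noteq> cnf_coeff g (Max ?D)"
      using Max_in[OF fin ne] by simp
    show "cnf_coeff f y = cnf_coeff g y" if "y > Max ?D" for y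
      using Max_ge[OF fin, of y] that by force
  qed
qed

instance
proof
  fix f g h :: "'a omega_pow"
  have irrefl: "\<not> f < f" for f :: "'a omega_pow" by (simp add: less_omega_pow_def)
  have tr: "f < h" if "f < g" "g < h" for f g h :: "'a omega_pow"
  proof -
    from that obtain x y where
      x: "cnf_coeff f x < cnf_coeff g x" "\<And>z. z > x \<Longrightarrow> cnf_coeff f z = cnf_coeff g z" and
      y: "cnf_coeff g y < cnf_coeff h y" "\<And>z. z > y \<Longrightarrow> cnf_coeff g z = cnf_coeff h z"
      unfolding less_omega_pow_def by blast
    have "cnf_coeff f (max x y) < cnf_coeff h (max x y)"
      using x y by (cases x y rule: linorder_cases) (auto simp: max_def)
    moreover have "cnf_coeff f z = cnf_coeff h z" if "z > max x y" for z
      using x y that by auto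
    ultimately show ?thesis unfolding less_omega_pow_def by blast
  qed
  show "(f < g) = (f \<le> g \<and> \<not> g \<le> f)"
    unfolding less_eq_omega_pow_def using irrefl[of f] tr[of f g f] by auto
  show "f \<le> f" by (simp add: less_eq_omega_pow_def)
  show "f \<le> g \<Longrightarrow> g \<le> h \<Longrightarrow> f \<le> h"
    unfolding less_eq_omega_pow_def using tr[of f g h] by auto
  show "f \<le> g \<Longrightarrow> g \<le> f \<Longrightarrow> f = g"
    unfolding less_eq_omega_pow_def using irrefl[of f] tr[of f g f] by auto
  show "f \<le> g \<or> g \<le> f"
  proof (cases "f = g")
    case False
    then obtain x where "cnf_coeff f x \<noteq> cnf_coeff g x"
        "\<And>y. y > x \<Longrightarrow> cnf_coeff f y = cnf_coeff g y"
      by (rule omega_pow_neqE) blast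
    then show ?thesis
      unfolding less_eq_omega_pow_def less_omega_pow_def by (metis nat_neq_iff)
  qed (simp add: less_eq_omega_pow_def)
qed

end

lemma omega_pow_lessI:
  fixes f g :: "'w::linorder omega_pow"
  assumes "cnf_coeff f x < cnf_coeff g x" "\<And>y. y > x \<Longrightarrow> cnf_coeff f y = cnf_coeff g y"
  shows "f < g"
  using assms unfolding less_omega_pow_def by blast

lemma omega_pow_leI:
  fixes f g :: "'w::linorder omega_pow"
  assumes "\<And>x. cnf_coeff f x \<le> cnf_coeff g x"
  shows "f \<le> g"
  using assms unfolding less_omega_pow_def by (metis less_omega_pow_def linorder_not_le)

lemma omega_pow_minimum_below:
  fixes k :: "'w::wellorder"
  assumes "g \<in> S" "\<And>f x. f \<in> S \<Longrightarrow> x > k \<Longrightarrow> cnf_coeff f x = cnf_coeff g x"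
  shows "\<exists>m\<in>S. \<forall>f\<in>S. m \<le> f"
  using assms
proof (induction k arbitrary: S g rule: less_induct)
  case (less k)
  define c where "c = (LEAST c. \<exists>f\<in>S. cnf_coeff f k = c)"
  have c: "\<exists>f\<in>S. cnf_coeff f k = c"
    unfolding c_def by (rule LeastI_ex) (use less.prems(1) in blast)
  have c_le: "c \<le> cnf_coeff f k" if "f \<in> S" for f
    unfolding c_def by (rule Least_le) (use that in blast)
  from c obtain h where h: "h \<in> S" "cnf_coeff h k = c" by blast
  have agree: "cnf_coeff f x = cnf_coeff h x" if "f \<in> S" "x > k" for f x
    using less.prems(2) h(1) that by metis
  have suff: ?case if m: "m \<in> S" "cnf_coeff m k = c"
      "\<And>f. f \<in> S \<Longrightarrow> cnf_coeff f k = c \<Longrightarrow> f \<le> h \<Longrightarrow> m \<le> f" "m \<le> h" for m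
  proof (intro bexI[of _ m] ballI)
    fix f assume f: "f \<in> S"
    show "m \<le> f"
    proof (cases "cnf_coeff f k = c")
      case True
      show ?thesis
      proof (cases "f \<le> h")
        case True
        with \<open>cnf_coeff f k = c\<close> show ?thesis by (intro m(3)[OF f])
      next
        case False
        then have "h \<le> f" by simp
        with m(4) show ?thesis by (rule order_trans)
      qed
    next
      case False
      then have "cnf_coeff m k < cnf_coeff f k" using c_le[OF f] m(2) by simp
      moreover have "cnf_coeff m y = cnf_coeff f y" if "y > k" for y
        using agree[OF f that] agree[OF m(1) that] by simp
      ultimately have "m < f" by (rule omega_pow_lessI)
      then show ?thesis by simp
    qed
  qed (rule m(1))
  let ?K = "{x. x < k \<and> cnf_coeff h x \<noteq> 0}"
  have finK: "finite ?K" by (rule finite_subset[OF _ finite_cnf_coeff[of h]]) auto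
  show ?case
  proof (cases "?K = {}")
    case True
    show ?thesis
    proof (rule suff[of h])
      fix f assume f: "f \<in> S" "cnf_coeff f k = c"
      show "h \<le> f"
      proof (rule omega_pow_leI)
        fix x
        show "cnf_coeff h x \<le> cnf_coeff f x"
          using True agree[OF f(1), of x] f(2) h(2) by (cases x k rule: linorder_cases) auto
      qed
    qed (use h in auto)
  next
    case False
    define k' where "k' = Max ?K"
    have k': "k' < k" using Max_in[OF finK False] by (simp add: k'_def)
    define T where "T = {f \<in> S. cnf_coeff f k = c \<and> f \<le> h}"
    have "\<exists>m\<in>T. \<forall>f\<in>T. m \<le> f"
    proof (rule less.IH[OF k', of h])
      show "h \<in> T" using h by (simp add: T_def)
      fix f x assume f: "f \<in> T" and x: "x > k'"
      have hz: "cnf_coeff h y = 0" if "y > k'" "y < k" for y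
        using Max_ge[OF finK, of y] that by (force simp: k'_def)
      show "cnf_coeff f x = cnf_coeff h x"
      proof (cases "f = h")
        case False
        with f have "f < h" by (auto simp: T_def)
        then obtain z where z: "cnf_coeff f z < cnf_coeff h z"
            "\<And>y. y > z \<Longrightarrow> cnf_coeff f y = cnf_coeff h y"
          unfolding less_omega_pow_def by blast
        have "\<not> z > k" using agree[of f z] f z(1) by (auto simp: T_def)
        moreover have "z \<noteq> k" using f h(2) z(1) by (auto simp: T_def)
        ultimately have "z \<le> k'" using hz[of z] z(1) by force
        then show ?thesis using x z(2) by simp
      qed simp
    qed
    then obtain m where m: "m \<in> T" "\<And>f. f \<in> T \<Longrightarrow> m \<le> f" by blast
    show ?thesis
      by (rule suff[of m]) (use m in \<open>auto simp: T_def\<close>)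
  qed
qed

lemma omega_pow_minimum:
  fixes S :: "'w::wellorder omega_pow set"
  assumes "g \<in> S"
  shows "\<exists>m\<in>S. \<forall>f\<in>S. m \<le> f"
proof (cases "\<forall>x. cnf_coeff g x = 0")
  case True
  then show ?thesis using assms by (intro bexI[of _ g]) (auto intro: omega_pow_leI)
next
  case False
  let ?K = "{x. cnf_coeff g x \<noteq> 0}"
  let ?T = "{f \<in> S. f \<le> g}"
  have fin: "finite ?K" by (rule finite_cnf_coeff)
  have gz: "cnf_coeff g y = 0" if "y > Max ?K" for y
    using Max_ge[OF fin, of y] that by force
  have "\<exists>m\<in>?T. \<forall>f\<in>?T. m \<le> f"
  proof (rule omega_pow_minimum_below[of g _ "Max ?K"])
    show "g \<in> ?T" using assms by simp
    fix f x assume f: "f \<in> ?T" and x: "x > Max ?K"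
    show "cnf_coeff f x = cnf_coeff g x"
    proof (cases "f = g")
      case False
      with f have "f < g" by auto
      then obtain z where z: "cnf_coeff f z < cnf_coeff g z"
          "\<And>y. y > z \<Longrightarrow> cnf_coeff f y = cnf_coeff g y"
        unfolding less_omega_pow_def by blast
      have "z \<le> Max ?K" using gz[of z] z(1) by force
      then show ?thesis using x z(2) by simp
    qed simp
  qed
  then obtain m where m: "m \<in> S" "m \<le> g" "\<And>f. f \<in> S \<Longrightarrow> f \<le> g \<Longrightarrow> m \<le> f" by blast
  have "m \<le> f" if "f \<in> S" for f
    using m(3)[OF that] m(2) by (cases "f \<le> g") auto
  with m(1) show ?thesis by blast
qed

instance omega_pow :: (wellorder) wellorder
proof
  fix P :: "'a omega_pow \<Rightarrow> bool" and a
  assume step: "\<And>x. (\<And>y. y < x \<Longrightarrow> P y) \<Longrightarrow> P x"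
  show "P a"
  proof (rule ccontr)
    assume "\<not> P a"
    then obtain m where m: "\<not> P m" "\<And>f. \<not> P f \<Longrightarrow> m \<le> f"
      using omega_pow_minimum[of a "{f. \<not> P f}"] by auto
    then show False using step[of m] by (meson not_le)
  qed
qed

text \<open>The Hessenberg sum adds the coefficients of Cantor normal forms.\<close>

instantiation omega_pow :: (type) cancel_comm_monoid_add
begin

lift_definition zero_omega_pow :: "'a omega_pow" is 0 .
lift_definition plus_omega_pow :: "'a omega_pow \<Rightarrow> 'a omega_pow \<Rightarrow> 'a omega_pow" is "(+)" .
lift_definition minus_omega_pow :: "'a omega_pow \<Rightarrow> 'a omega_pow \<Rightarrow> 'a omega_pow" is "(-)" .

instance
  by standard (transfer; simp add: algebra_simps)+

end

lemma cnf_coeff_add [simp]: "cnf_coeff (f + g) x = cnf_coeff f x + cnf_coeff g x"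
  by transfer (simp add: lookup_add)

lemma cnf_coeff_zero [simp]: "cnf_coeff 0 x = 0"
  by transfer simp

lemma omega_pow_add_strict_left_mono:
  fixes f g h :: "'w::linorder omega_pow"
  assumes "f < g"
  shows "h + f < h + g"
  using assms unfolding less_omega_pow_def by auto

instance omega_pow :: (linorder) ordered_cancel_comm_monoid_add
  by standard (metis less_eq_omega_pow_def omega_pow_add_strict_left_mono)

instance omega_pow :: (linorder) linordered_cancel_ab_semigroup_add
  by standard

text \<open>
  The Hessenberg product distributes over the Hessenberg sum and multiplies powers of \<open>\<omega>\<close> by forming
  the Hessenberg sum of the exponents, so it is the convolution product of coefficient functions.
  It is used for exponents in a type \<open>'w omega_pow\<close>, that is, on \<open>'w omega_pow omega_pow\<close>.
\<close>

instantiation omega_pow :: (comm_monoid_add) comm_semiring_1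
begin

lift_definition one_omega_pow :: "'a omega_pow" is 1 .
lift_definition times_omega_pow :: "'a omega_pow \<Rightarrow> 'a omega_pow \<Rightarrow> 'a omega_pow" is "(*)" .

instance
  by standard (transfer; simp add: algebra_simps)+

end

lemma omega_exp_zero: "omega_exp 0 = (1 :: 'w::comm_monoid_add omega_pow)"
  by transfer (simp del: One_nat_def)

lemma omega_exp_mult: "omega_exp x * omega_exp y = omega_exp (x + y :: 'w::comm_monoid_add)"
  by transfer (simp add: mult_single)

lemma cnf_coeff_mult:
  fixes f g :: "'w::comm_monoid_add omega_pow"
  assumes S: "finite S" "\<And>x. cnf_coeff f x \<noteq> 0 \<Longrightarrow> x \<in> S" "\<And>x. cnf_coeff g x \<noteq> 0 \<Longrightarrow> x \<in> S"
  shows "cnf_coeff (f * g) z =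
    (\<Sum>x\<in>S. \<Sum>y\<in>S. if z = x + y then cnf_coeff f x * cnf_coeff g y else 0)"
  using assms
proof transfer
  fix S :: "'w set" and f g :: "'w \<Rightarrow>\<^sub>0 nat" and z
  assume S: "finite S" "\<And>x. Poly_Mapping.lookup f x \<noteq> 0 \<Longrightarrow> x \<in> S" "\<And>x. Poly_Mapping.lookup g x \<noteq> 0 \<Longrightarrow> x \<in> S"
  have inner: "(\<Sum>q. Poly_Mapping.lookup g q when z = x + q) = (\<Sum>q\<in>S. Poly_Mapping.lookup g q when z = x + q)" for x
    by (rule Sum_any.expand_superset) (use S in \<open>auto simp: when_def\<close>)
  have "Poly_Mapping.lookup (f * g) z = (\<Sum>x. Poly_Mapping.lookup f x * (\<Sum>q. Poly_Mapping.lookup g q when z = x + q))"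
    by (rule lookup_mult)
  also have "\<dots> = (\<Sum>x\<in>S. Poly_Mapping.lookup f x * (\<Sum>q. Poly_Mapping.lookup g q when z = x + q))"
    by (rule Sum_any.expand_superset) (use S in auto)
  also have "\<dots> = (\<Sum>x\<in>S. \<Sum>y\<in>S. if z = x + y then Poly_Mapping.lookup f x * Poly_Mapping.lookup g y else 0)"
    unfolding inner unfolding sum_distrib_left when_def by (intro sum.cong refl) auto
  finally show "Poly_Mapping.lookup (f * g) z =
    (\<Sum>x\<in>S. \<Sum>y\<in>S. if z = x + y then Poly_Mapping.lookup f x * Poly_Mapping.lookup g y else 0)" .
qed

lemma omega_pow_mult_rearrange:
  fixes a1 a2 b1 b2 :: "'w::{linorder,ordered_cancel_comm_monoid_add} omega_pow"
  assumes "a2 < a1" "b2 < b1"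
  shows "a1 * b2 + a2 * b1 < a1 * b1 + a2 * b2"
proof -
  from assms obtain s t where
    s: "cnf_coeff a2 s < cnf_coeff a1 s" "\<And>y. y > s \<Longrightarrow> cnf_coeff a2 y = cnf_coeff a1 y" and
    t: "cnf_coeff b2 t < cnf_coeff b1 t" "\<And>y. y > t \<Longrightarrow> cnf_coeff b2 y = cnf_coeff b1 y"
    unfolding less_omega_pow_def by blast
  define S where "S = {x. cnf_coeff a1 x \<noteq> 0} \<union> {x. cnf_coeff a2 x \<noteq> 0} \<union>
    {x. cnf_coeff b1 x \<noteq> 0} \<union> {x. cnf_coeff b2 x \<noteq> 0}"
  have fin: "finite S" unfolding S_def by (intro finite_UnI finite_cnf_coeff)
  have stS: "s \<in> S" "t \<in> S" using s(1) t(1) by (auto simp: S_def)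
  define p where "p x = int (cnf_coeff a1 x) - int (cnf_coeff a2 x)" for x
  define q where "q x = int (cnf_coeff b1 x) - int (cnf_coeff b2 x)" for x
  have conv: "int (cnf_coeff (f * g) z) =
      (\<Sum>x\<in>S. \<Sum>y\<in>S. if z = x + y then int (cnf_coeff f x) * int (cnf_coeff g y) else 0)"
    if "f \<in> {a1, a2}" "g \<in> {b1, b2}" for f g z
    by (subst cnf_coeff_mult[OF fin])
      (use that in \<open>auto simp: S_def of_nat_sum if_distrib cong: if_cong intro!: sum.cong\<close>)
  have diff: "int (cnf_coeff (a1 * b1 + a2 * b2) z) - int (cnf_coeff (a1 * b2 + a2 * b1) z) =
      (\<Sum>x\<in>S. \<Sum>y\<in>S. if z = x + y then p x * q y else 0)" for z
    by (simp add: conv sum.distrib[symmetric] sum_subtractf[symmetric] p_def q_def)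
      (auto intro!: sum.cong simp: p_def q_def algebra_simps)
  have p0: "p x = 0" if "x > s" for x using s(2)[OF that] by (simp add: p_def)
  have q0: "q x = 0" if "x > t" for x using t(2)[OF that] by (simp add: q_def)
  show ?thesis
  proof (rule omega_pow_lessI[of _ "s + t"])
    have "(\<Sum>x\<in>S. \<Sum>y\<in>S. if s + t = x + y then p x * q y else 0) =
        (\<Sum>x\<in>S. \<Sum>y\<in>S. if x = s \<and> y = t then p x * q y else 0)"
    proof (intro sum.cong refl)
      fix x y
      show "(if s + t = x + y then p x * q y else 0) = (if x = s \<and> y = t then p x * q y else 0)"
      proof (cases "x > s \<or> y > t")
        case True
        then show ?thesis using p0 q0 by auto
      next
        case False
        then have le: "x \<le> s" "y \<le> t" by auto
        have "x = s \<and> y = t" if "s + t = x + y"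
          using le that add_less_le_mono[of x s y t] add_le_less_mono[of x s y t]
          by (metis order_le_less order_less_irrefl)
        then show ?thesis by auto
      qed
    qed
    also have "\<dots> = (\<Sum>x\<in>S. if x = s then p s * q t else 0)"
    proof (intro sum.cong refl)
      fix x
      have "(\<Sum>y\<in>S. if x = s \<and> y = t then p x * q y else 0) =
          (\<Sum>y\<in>S. if y = t then (if x = s then p s * q t else 0) else 0)"
        by (intro sum.cong refl) auto
      then show "(\<Sum>y\<in>S. if x = s \<and> y = t then p x * q y else 0) =
          (if x = s then p s * q t else 0)"
        using fin stS by simp
    qed
    also have "\<dots> = p s * q t" using fin stS by simp
    also have "\<dots> > 0" using s(1) t(1) by (simp add: p_def q_def)
    finally show "cnf_coeff (a1 * b2 + a2 * b1) (s + t) < cnf_coeff (a1 * b1 + a2 * b2) (s + t)"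
      using diff[of "s + t"] by linarith
  next
    fix z assume z: "z > s + t"
    have "(if z = x + y then p x * q y else 0) = 0" for x y
    proof (cases "x > s \<or> y > t")
      case True
      then show ?thesis using p0 q0 by auto
    next
      case False
      then have "x + y \<le> s + t" by (intro add_mono) auto
      then show ?thesis using z by auto
    qed
    then have "(\<Sum>x\<in>S. \<Sum>y\<in>S. if z = x + y then p x * q y else 0) = 0"
      by (intro sum.neutral ballI) auto
    then show "cnf_coeff (a1 * b2 + a2 * b1) z = cnf_coeff (a1 * b1 + a2 * b2) z"
      using diff[of z] by linarith
  qed
qed


section \<open>Differences and fractions of ordinals\<close>

lifting_forget omega_pow.lifting

fun ord_diff_rel :: "'w omega_pow omega_pow \<times> 'w omega_pow omega_pow \<Rightarrow>
    'w omega_pow omega_pow \<times> 'w omega_pow omega_pow \<Rightarrow> bool" where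
  "ord_diff_rel (a, b) (c, d) \<longleftrightarrow> a + d = b + c"

quotient_type 'w ord_int =
  "'w omega_pow omega_pow \<times> 'w omega_pow omega_pow" / ord_diff_rel
  morphisms Rep_ord_int Abs_ord_int
proof (rule equivpI)
  show "reflp (ord_diff_rel :: 'w omega_pow omega_pow \<times> _ \<Rightarrow> _)"
    by (rule reflpI) (auto simp: add.commute)
  show "symp (ord_diff_rel :: 'w omega_pow omega_pow \<times> _ \<Rightarrow> _)"
    by (rule sympI) (auto simp: add.commute)
  show "transp (ord_diff_rel :: 'w omega_pow omega_pow \<times> _ \<Rightarrow> _)"
  proof (rule transpI, clarsimp)
    fix a b c d e f :: "'w omega_pow omega_pow"
    assume 1: "a + d = b + c" and 2: "c + f = d + e"
    have "(a + f) + (d + c) = (a + d) + (c + f)" by (simp add: ac_simps)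
    also have "\<dots> = (b + e) + (d + c)" unfolding 1 2 by (simp add: ac_simps)
    finally show "a + f = b + e" by simp
  qed
qed

lift_definition ord_diff ::
  "'w omega_pow omega_pow \<Rightarrow> 'w omega_pow omega_pow \<Rightarrow> 'w ord_int" is Pair .

instantiation ord_int :: (linorder) comm_ring_1
begin

lift_definition zero_ord_int :: "'a ord_int" is "(0, 0)" .
lift_definition one_ord_int :: "'a ord_int" is "(1, 0)" .

lift_definition uminus_ord_int :: "'a ord_int \<Rightarrow> 'a ord_int" is "\<lambda>(a, b). (b, a)"
  by auto

lift_definition plus_ord_int :: "'a ord_int \<Rightarrow> 'a ord_int \<Rightarrow> 'a ord_int"
  is "\<lambda>(a, b) (c, d). (a + c, b + d)"
proof clarsimp
  fix a b a' b' c d c' d' :: "'a omega_pow omega_pow"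
  assume 1: "a + b' = b + a'" and 2: "c + d' = d + c'"
  have "a + c + (b' + d') = (a + b') + (c + d')" by (simp add: ac_simps)
  also have "\<dots> = b + d + (a' + c')" unfolding 1 2 by (simp add: ac_simps)
  finally show "a + c + (b' + d') = b + d + (a' + c')" .
qed

definition minus_ord_int :: "'a ord_int \<Rightarrow> 'a ord_int \<Rightarrow> 'a ord_int" where
  "x - y = x + - (y :: 'a ord_int)"

lift_definition times_ord_int :: "'a ord_int \<Rightarrow> 'a ord_int \<Rightarrow> 'a ord_int"
  is "\<lambda>(a, b) (c, d). (a * c + b * d, a * d + b * c)"
proof clarsimp
  fix a b a' b' c d c' d' :: "'a omega_pow omega_pow"
  assume 1: "a + b' = b + a'" and 2: "c + d' = d + c'"
  have "(a * c + b * d + (a' * d' + b' * c')) + (b' * c + b' * d + a' * c + a' * d)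
      = (a + b') * c + (b + a') * d + b' * (d + c') + a' * (c + d')"
    by (simp add: algebra_simps)
  also have "\<dots> = (b + a') * c + (a + b') * d + b' * (c + d') + a' * (d + c')"
    unfolding 1 2 ..
  also have "\<dots> = (a * d + b * c + (a' * c' + b' * d')) + (b' * c + b' * d + a' * c + a' * d)"
    by (simp add: algebra_simps)
  finally show "a * c + b * d + (a' * d' + b' * c') = a * d + b * c + (a' * c' + b' * d')"
    by simp
qed

instance
proof
  fix x y z :: "'a ord_int"
  show "x + y + z = x + (y + z)" "x + y = y + x" "0 + x = x" "- x + x = 0"
    by (transfer, clarsimp simp: ac_simps)+
  show "x - y = x + - y" by (rule minus_ord_int_def)
  show "x * y * z = x * (y * z)" "x * y = y * x" "1 * x = x" "(x + y) * z = x * z + y * z"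
    by (transfer, clarsimp simp: algebra_simps)+
  show "(0::'a ord_int) \<noteq> 1" by transfer simp
qed

end

instantiation ord_int :: (linorder) linordered_idom
begin

lift_definition less_eq_ord_int :: "'a ord_int \<Rightarrow> 'a ord_int \<Rightarrow> bool"
  is "\<lambda>(b1, b2) (a1, a2). a1 + b2 \<ge> a2 + b1"
proof clarsimp
  fix b1 b2 b1' b2' a1 a2 a1' a2' :: "'a omega_pow omega_pow"
  assume 1: "b1 + b2' = b2 + b1'" and 2: "a1 + a2' = a2 + a1'"
  have "a2 + b1 \<le> a1 + b2 \<longleftrightarrow> (a2 + b1) + (a1' + b2') \<le> (a1 + b2) + (a1' + b2')" by simp
  also have "(a2 + b1) + (a1' + b2') = (a2 + a1') + (b1 + b2')" by (simp add: ac_simps)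
  also have "\<dots> = (a1 + b2) + (a2' + b1')" unfolding 1 2[symmetric] by (simp add: ac_simps)
  also have "(a1 + b2) + (a2' + b1') \<le> (a1 + b2) + (a1' + b2') \<longleftrightarrow> a2' + b1' \<le> a1' + b2'" by simp
  finally show "a2 + b1 \<le> a1 + b2 \<longleftrightarrow> a2' + b1' \<le> a1' + b2'" .
qed

definition less_ord_int :: "'a ord_int \<Rightarrow> 'a ord_int \<Rightarrow> bool" where
  "x < y \<longleftrightarrow> x \<le> y \<and> \<not> y \<le> (x :: 'a ord_int)"

definition abs_ord_int :: "'a ord_int \<Rightarrow> 'a ord_int" where
  "\<bar>x\<bar> = (if x < 0 then - x else x :: 'a ord_int)"

definition sgn_ord_int :: "'a ord_int \<Rightarrow> 'a ord_int" where
  "sgn x = (if x = 0 then 0 else if 0 < x then 1 else - 1 :: 'a ord_int)"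

instance
proof
  fix x y z :: "'a ord_int"
  show "(x < y) = (x \<le> y \<and> \<not> y \<le> x)" by (rule less_ord_int_def)
  show "x \<le> x" by transfer (clarsimp simp: add.commute)
  show "x \<le> y \<Longrightarrow> y \<le> z \<Longrightarrow> x \<le> z"
  proof (transfer, clarsimp)
    fix a b c d e f :: "'a omega_pow omega_pow"
    assume 1: "d + a \<le> c + b" and 2: "f + c \<le> e + d"
    have "(f + a) + (c + d) = (d + a) + (f + c)" by (simp add: ac_simps)
    also have "\<dots> \<le> (c + b) + (e + d)" by (rule add_mono[OF 1 2])
    also have "\<dots> = (e + b) + (c + d)" by (simp add: ac_simps)
    finally show "f + a \<le> e + b" by simp
  qed
  show "x \<le> y \<Longrightarrow> y \<le> x \<Longrightarrow> x = y"
    by transfer (clarsimp simp: ac_simps)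
  show "x \<le> y \<or> y \<le> x"
    by transfer (clarsimp simp: ac_simps not_le less_imp_le)
  show "x \<le> y \<Longrightarrow> z + x \<le> z + y"
  proof (transfer, clarsimp)
    fix a b c d e f :: "'a omega_pow omega_pow"
    assume "d + a \<le> c + b"
    then have "(f + e) + (d + a) \<le> (f + e) + (c + b)" by simp
    then show "f + d + (e + a) \<le> e + c + (f + b)" by (simp add: ac_simps)
  qed
  show "x < y \<Longrightarrow> 0 < z \<Longrightarrow> z * x < z * y"
    unfolding less_ord_int_def
  proof (transfer, clarsimp simp: not_le)
    fix a b c d e f :: "'a omega_pow omega_pow"
    assume *: "a + d < b + c" "f \<le> e" "e \<noteq> f"
    then have "f < e" by simp
    with *(1) have "e * (a + d) + f * (b + c) < e * (b + c) + f * (a + d)"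
      by (rule omega_pow_mult_rearrange[rotated])
    then have "e * d + f * c + (e * a + f * b) < e * c + f * d + (e * b + f * a)"
      by (simp add: algebra_simps)
    then show "e * d + f * c + (e * a + f * b) \<le> e * c + f * d + (e * b + f * a) \<and>
        e * a + f * b + (e * d + f * c) < e * b + f * a + (e * c + f * d)"
      by (simp add: add.commute)
  qed
  show "\<bar>x\<bar> = (if x < 0 then - x else x)" by (rule abs_ord_int_def)
  show "sgn x = (if x = 0 then 0 else if 0 < x then 1 else - 1)" by (rule sgn_ord_int_def)
qed

end

lemma ord_diff_eq_iff: "ord_diff a b = ord_diff c d \<longleftrightarrow> a + d = b + c"
  by transfer simp

lemma ord_diff_arith:
  fixes a b c d :: "'w::linorder omega_pow omega_pow"
  shows "0 = ord_diff 0 (0 :: 'w omega_pow omega_pow)"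
    and "1 = ord_diff 1 (0 :: 'w omega_pow omega_pow)"
    and "ord_diff a b + ord_diff c d = ord_diff (a + c) (b + d)"
    and "- ord_diff a b = ord_diff b a"
    and "ord_diff a b * ord_diff c d = ord_diff (a * c + b * d) (a * d + b * c)"
  by (transfer, simp add: add.commute)+

lemma ord_diff_le_iff:
  fixes a1 a2 b1 b2 :: "'w::linorder omega_pow omega_pow"
  shows "ord_diff a1 a2 \<ge> ord_diff b1 b2 \<longleftrightarrow> a1 + b2 \<ge> a2 + b1"
  by transfer simp

text \<open>
  The library order on fractions is the one given by the sign of the product of numerator and
  denominator.
\<close>

type_synonym 'w ord_rat = "'w ord_int fract"

lemma ord_rat_nonneg_iff:
  fixes a b :: "'w::linorder ord_int"
  assumes "b \<noteq> 0"
  shows "0 \<le> Fract a b \<longleftrightarrow> 0 \<le> a * b"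
  using assms by (simp add: Zero_fract_def)


section \<open>\<open>\<nat>\<^sub>\<alpha>\<close>, \<open>\<int>\<^sub>\<alpha>\<close> and \<open>\<rat>\<^sub>\<alpha>\<close>\<close>

text \<open>
  An element \<open>\<alpha>\<close> of a well-ordered type is identified with the order type of its set of predecessors.
  \<open>\<int>\<^sub>\<alpha>\<close> and \<open>\<rat>\<^sub>\<alpha>\<close> carry the operations and the order of the ambient ring and field. Two fractions
  over \<open>\<int>\<^sub>\<alpha>\<close> are equal in the ambient field if and only if they are equal over \<open>\<int>\<^sub>\<alpha>\<close>, and likewise for
  differences, so these are the Grothendieck ring of \<open>\<nat>\<^sub>\<alpha>\<close> and its field of fractions.
\<close>

definition ord_Nats :: "'w::wellorder \<Rightarrow> 'w omega_pow omega_pow set" where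
  "ord_Nats \<alpha> = {\<nu>. \<nu> < omega_exp (omega_exp \<alpha>)}"

definition ord_Ints :: "'w::wellorder \<Rightarrow> 'w ord_int set" where
  "ord_Ints \<alpha> = {ord_diff a b | a b. a \<in> ord_Nats \<alpha> \<and> b \<in> ord_Nats \<alpha>}"

definition ord_Rats :: "'w::wellorder \<Rightarrow> 'w ord_rat set" where
  "ord_Rats \<alpha> = {Fract a b | a b. a \<in> ord_Ints \<alpha> \<and> b \<in> ord_Ints \<alpha> \<and> b \<noteq> 0}"

lemma cnf_coeff_omega_exp: "cnf_coeff (omega_exp x) y = (if x = y then 1 else 0)"
  by (simp add: cnf_coeff.rep_eq omega_exp.rep_eq lookup_single when_def)

lemma less_omega_exp_iff:
  fixes f :: "'w::linorder omega_pow"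
  shows "f < omega_exp x \<longleftrightarrow> (\<forall>y. cnf_coeff f y \<noteq> 0 \<longrightarrow> y < x)"
proof
  assume "f < omega_exp x"
  then obtain z where z: "cnf_coeff f z < cnf_coeff (omega_exp x) z"
      "\<And>y. y > z \<Longrightarrow> cnf_coeff f y = cnf_coeff (omega_exp x) y"
    unfolding less_omega_pow_def by blast
  have [simp]: "z = x" and "cnf_coeff f x = 0"
    using z(1) by (auto simp: cnf_coeff_omega_exp split: if_splits)
  show "\<forall>y. cnf_coeff f y \<noteq> 0 \<longrightarrow> y < x"
  proof (intro allI impI)
    fix y assume y: "cnf_coeff f y \<noteq> 0"
    show "y < x"
      using y \<open>cnf_coeff f x = 0\<close> z(2)[of y]
      by (cases y x rule: linorder_cases) (auto simp: cnf_coeff_omega_exp split: if_splits)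
  qed
next
  assume *: "\<forall>y. cnf_coeff f y \<noteq> 0 \<longrightarrow> y < x"
  show "f < omega_exp x"
  proof (rule omega_pow_lessI[of _ x])
    show "cnf_coeff f x < cnf_coeff (omega_exp x) x"
      using * by (auto simp: cnf_coeff_omega_exp)
    show "cnf_coeff f y = cnf_coeff (omega_exp x) y" if "y > x" for y
      using * that by (auto simp: cnf_coeff_omega_exp)
  qed
qed

lemma omega_exp_add_closed:
  fixes f g :: "'w::linorder omega_pow"
  assumes "f < omega_exp x" "g < omega_exp x"
  shows "f + g < omega_exp x"
  using assms unfolding less_omega_exp_iff by auto

lemma ord_Nats_add:
  "\<mu> \<in> ord_Nats \<alpha> \<Longrightarrow> \<nu> \<in> ord_Nats \<alpha> \<Longrightarrow> \<mu> + \<nu> \<in> ord_Nats \<alpha>"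
  by (simp add: ord_Nats_def omega_exp_add_closed)

lemma ord_Nats_mult:
  assumes "\<mu> \<in> ord_Nats \<alpha>" "\<nu> \<in> ord_Nats \<alpha>"
  shows "\<mu> * \<nu> \<in> ord_Nats \<alpha>"
proof -
  let ?S = "{x. cnf_coeff \<mu> x \<noteq> 0} \<union> {x. cnf_coeff \<nu> x \<noteq> 0}"
  have fin: "finite ?S" by (intro finite_UnI finite_cnf_coeff)
  have "z < omega_exp \<alpha>" if z: "cnf_coeff (\<mu> * \<nu>) z \<noteq> 0" for z
  proof -
    have "\<exists>x y. z = x + y \<and> cnf_coeff \<mu> x * cnf_coeff \<nu> y \<noteq> 0"
    proof (rule ccontr)
      assume "\<not> ?thesis"
      then have *: "cnf_coeff \<mu> x * cnf_coeff \<nu> y = 0" if "z = x + y" for x y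
        using that by blast
      have "cnf_coeff (\<mu> * \<nu>) z = 0"
        by (subst cnf_coeff_mult[OF fin], simp, simp) (auto simp: * intro!: sum.neutral simp del: mult_eq_0_iff)
      with z show False by simp
    qed
    then obtain x y where xy: "z = x + y" "cnf_coeff \<mu> x \<noteq> 0" "cnf_coeff \<nu> y \<noteq> 0" by auto
    then have "x < omega_exp \<alpha>" "y < omega_exp \<alpha>"
      using assms by (auto simp: ord_Nats_def less_omega_exp_iff[of \<mu>] less_omega_exp_iff[of \<nu>])
    then show ?thesis unfolding xy(1) by (rule omega_exp_add_closed)
  qed
  then show ?thesis by (simp add: ord_Nats_def less_omega_exp_iff[of "\<mu> * \<nu>"])
qed


section \<open>Dedekind cuts\<close>

text \<open>
  Throughout, \<open>K\<close> is (the carrier of) an ordered subfield of \<open>'q\<close>, namely \<open>\<rat>\<^sub>\<alpha>\<close>, and suprema and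
  infima are taken in \<open>K\<close>, where they need not exist.

  The clause on \<open>q\<close> requires a missing element to lie between \<open>A\<close> and \<open>B\<close>, so that \<open>A\<close> is an initial
  and \<open>B\<close> a final segment of \<open>K\<close>. Without it, an arbitrary point could be removed from one side of
  a cut at a gap of \<open>K\<close>, the order by inclusion would not be total, and inverses of cuts would in
  general not be cuts.
\<close>

definition dedekind_cuts :: "'q::linordered_field set \<Rightarrow> ('q set \<times> 'q set) set" where
  "dedekind_cuts K = {(A, B). A \<subseteq> K \<and> B \<subseteq> K \<and>
     (\<forall>a\<in>A. \<forall>b\<in>B. a < b) \<and>
     (\<forall>p\<in>K - (A \<union> B). \<forall>q\<in>K - (A \<union> B). p = q) \<and>
     (\<forall>q\<in>K - (A \<union> B). (\<forall>a\<in>A. a < q) \<and> (\<forall>b\<in>B. q < b)) \<and>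
     (\<forall>i. isGlb K B i \<longrightarrow> i \<notin> B) \<and> (\<forall>s. isLub K A s \<longrightarrow> s \<notin> A) \<and>
     A \<inter> B = {}}"

definition balls :: "'q::linordered_field set \<Rightarrow> 'q set set" where
  "balls K = {{y \<in> K. \<bar>x - y\<bar> < r} | x r. x \<in> K \<and> r \<in> K \<and> 0 < r}"

definition improper_cut :: "'q::linordered_field set \<Rightarrow> 'q set \<times> 'q set \<Rightarrow> bool" where
  "improper_cut K = (\<lambda>(A, B). \<exists>d\<in>K. 0 < d \<and>
     (\<forall>U\<in>balls K. U \<inter> A \<noteq> {} \<and> U \<inter> B \<noteq> {} \<longrightarrow>
        (\<exists>s i. isLub K U s \<and> isGlb K U i \<and> s - i > d)))"

abbreviation proper_cut :: "'q::linordered_field set \<Rightarrow> 'q set \<times> 'q set \<Rightarrow> bool" where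
  "proper_cut K x \<equiv> \<not> improper_cut K x"

definition cut_zero :: "'q::linordered_field set \<Rightarrow> 'q set \<times> 'q set" where
  "cut_zero K = ({q \<in> K. q < 0}, {q \<in> K. q > 0})"

definition cut_one :: "'q::linordered_field set \<Rightarrow> 'q set \<times> 'q set" where
  "cut_one K = ({q \<in> K. q < 1}, {q \<in> K. q > 1})"

definition cut_le :: "'q set \<times> 'q set \<Rightarrow> 'q set \<times> 'q set \<Rightarrow> bool" where
  "cut_le x y \<longleftrightarrow> fst x \<subseteq> fst y"

definition cut_less :: "'q set \<times> 'q set \<Rightarrow> 'q set \<times> 'q set \<Rightarrow> bool" where
  "cut_less x y \<longleftrightarrow> cut_le x y \<and> x \<noteq> y"

definition cut_uminus :: "'q::linordered_field set \<times> 'q set \<Rightarrow> 'q set \<times> 'q set" where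
  "cut_uminus = (\<lambda>(A, B). (uminus ` B, uminus ` A))"

definition cut_abs :: "'q::linordered_field set \<Rightarrow> 'q set \<times> 'q set \<Rightarrow> 'q set \<times> 'q set" where
  "cut_abs K x = (if cut_less x (cut_zero K) then cut_uminus x else x)"

text \<open>
  The lower set of a product of nonnegative cuts consists of the products of nonnegative elements
  of the lower sets, together with all negative elements. All products of elements of the lower
  sets would not do: these sets contain all negative elements, whose products are unbounded above.
\<close>

definition cut_mult_nonneg ::
  "'q::linordered_field set \<Rightarrow> 'q set \<times> 'q set \<Rightarrow> 'q set \<times> 'q set \<Rightarrow> 'q set \<times> 'q set" where
  "cut_mult_nonneg K = (\<lambda>(A, B) (C, D).
     ({q \<in> K. q < 0} \<union> {x * y | x y. x \<in> A \<and> y \<in> C \<and> 0 \<le> x \<and> 0 \<le> y},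
      {x * y | x y. x \<in> B \<and> y \<in> D}))"

definition cut_mult ::
  "'q::linordered_field set \<Rightarrow> 'q set \<times> 'q set \<Rightarrow> 'q set \<times> 'q set \<Rightarrow> 'q set \<times> 'q set" where
  "cut_mult K x y =
     (if (cut_less (cut_zero K) x \<longleftrightarrow> cut_less (cut_zero K) y) \<and>
         (cut_less x (cut_zero K) \<longleftrightarrow> cut_less y (cut_zero K))
      then cut_mult_nonneg K (cut_abs K x) (cut_abs K y)
      else cut_uminus (cut_mult_nonneg K (cut_abs K x) (cut_abs K y)))"

definition cut_inverse_pos :: "'q::linordered_field set \<Rightarrow> 'q set \<times> 'q set \<Rightarrow> 'q set \<times> 'q set" where
  "cut_inverse_pos K = (\<lambda>(A, B).
     let C = {1 / y | y. y \<in> B} \<union> {q \<in> K. q \<le> 0} in (C, K - (C \<union> {s. isLub K C s})))"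

text \<open>The inverse of the zero cut is not meaningful.\<close>

definition cut_inverse :: "'q::linordered_field set \<Rightarrow> 'q set \<times> 'q set \<Rightarrow> 'q set \<times> 'q set" where
  "cut_inverse K x =
     (if cut_less (cut_zero K) x then cut_inverse_pos K x
      else cut_uminus (cut_inverse_pos K (cut_abs K x)))"

end

theory Submission
  imports Defs
begin

text \<open>
  A cut with nonempty sides is proper iff its two sides come arbitrarily close to each other. For
  \<open>x > 0\<close> fix \<open>a\<^sub>0 \<in> A\<close> with \<open>a\<^sub>0 > 0\<close>; it suffices to consider \<open>a \<ge> a\<^sub>0\<close>. Then
  \<open>1/a - 1/b = (b - a)/(ab)\<close> is at most \<open>(b - a)/a\<^sub>0\<^sup>2\<close>, so \<open>1/x\<close> is proper, and \<open>a/b\<close> and \<open>b/a\<close>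
  come arbitrarily close to 1, so the product fills both sides of the unit cut. Negative cuts reduce
  to positive ones by taking opposites. Only the closure of \<open>\<rat>\<^sub>\<alpha>\<close> under the field operations is used.
\<close>

section \<open>Suprema, infima and intervals in an ordered subfield\<close>

lemma isLub_iff:
  "isLub K S s \<longleftrightarrow> s \<in> K \<and> (\<forall>y\<in>S. y \<le> s) \<and> (\<forall>u\<in>K. (\<forall>y\<in>S. y \<le> u) \<longrightarrow> s \<le> u)"
  by (auto simp: isLub_def isUb_def leastP_def setle_def setge_def)

lemma isGlb_iff:
  "isGlb K S i \<longleftrightarrow> i \<in> K \<and> (\<forall>y\<in>S. i \<le> y) \<and> (\<forall>l\<in>K. (\<forall>y\<in>S. l \<le> y) \<longrightarrow> l \<le> i)"
  by (auto simp: isGlb_def isLb_def greatestP_def setle_def setge_def)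

text \<open>A carrier set is used instead of a type because \<open>ord_Rats \<alpha>\<close> varies
  with \<open>\<alpha>\<close>. The order is that of \<open>'q\<close>, and
  \<open>inverse_closed\<close> can include 0 because \<open>inverse 0 = 0\<close>.\<close>

locale ordered_subfield =
  fixes K :: "'q::linordered_field set"
  assumes zero_closed [simp]: "0 \<in> K"
    and one_closed [simp]: "1 \<in> K"
    and add_closed [simp]: "x \<in> K \<Longrightarrow> y \<in> K \<Longrightarrow> x + y \<in> K"
    and uminus_closed [simp]: "x \<in> K \<Longrightarrow> - x \<in> K"
    and mult_closed [simp]: "x \<in> K \<Longrightarrow> y \<in> K \<Longrightarrow> x * y \<in> K"
    and inverse_closed [simp]: "x \<in> K \<Longrightarrow> inverse x \<in> K"
begin

lemma diff_closed [simp]: "x \<in> K \<Longrightarrow> y \<in> K \<Longrightarrow> x - y \<in> K"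
  using add_closed[of x "- y"] by simp

lemma divide_closed [simp]: "x \<in> K \<Longrightarrow> y \<in> K \<Longrightarrow> x / y \<in> K"
  by (simp add: divide_inverse)

lemma two_closed [simp]: "2 \<in> K"
  using add_closed[of 1 1] by simp

lemma dense: "x \<in> K \<Longrightarrow> y \<in> K \<Longrightarrow> x < y \<Longrightarrow> \<exists>z\<in>K. x < z \<and> z < y"
  by (rule bexI[of _ "(x + y) / 2"]) (auto simp: field_simps)

lemma ball_eq: "{y \<in> K. \<bar>x - y\<bar> < r} = {y \<in> K. x - r < y \<and> y < x + r}"
  by (auto simp: abs_less_iff algebra_simps)

text \<open>Suprema in \<open>K\<close> may fail to exist, but density supplies this one: a bound
  \<open>v < u\<close> would leave an element of \<open>K\<close> between \<open>max l v\<close> and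
  \<open>u\<close>. The maximum keeps that element inside the interval.\<close>

lemma isLub_interval:
  assumes "l \<in> K" "u \<in> K" "l < u"
  shows "isLub K {y \<in> K. l < y \<and> y < u} u"
proof -
  have "u \<le> v" if v: "v \<in> K" "\<forall>y\<in>{y \<in> K. l < y \<and> y < u}. y \<le> v" for v
  proof (rule ccontr)
    assume "\<not> u \<le> v"
    then have "max l v < u" "max l v \<in> K" using assms v by (auto simp: max_def)
    then obtain z where "z \<in> K" "max l v < z" "z < u" using dense[of "max l v" u] assms by auto
    then show False using v(2) by force
  qed
  then show ?thesis using assms by (auto simp: isLub_iff)
qed

lemma isGlb_interval:
  assumes "l \<in> K" "u \<in> K" "l < u"
  shows "isGlb K {y \<in> K. l < y \<and> y < u} l"
proof -
  have "v \<le> l" if v: "v \<in> K" "\<forall>y\<in>{y \<in> K. l < y \<and> y < u}. v \<le> y" for v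
  proof (rule ccontr)
    assume "\<not> v \<le> l"
    then have "l < min u v" "min u v \<in> K" using assms v by (auto simp: min_def)
    then obtain z where "z \<in> K" "l < z" "z < min u v" using dense[of l "min u v"] assms by auto
    then show False using v(2) by force
  qed
  then show ?thesis using assms by (auto simp: isGlb_iff)
qed

text \<open>A ball of radius \<open>r\<close> has diameter exactly \<open>2 * r\<close>, so
  diameters of balls can be traded for distances \<open>b - a\<close>. If a side is empty, no ball
  meets both sides and both statements fail.\<close>

lemma proper_cut_iff:
  assumes "A \<subseteq> K" "B \<subseteq> K" "\<And>a b. a \<in> A \<Longrightarrow> b \<in> B \<Longrightarrow> a < b"
  shows "proper_cut K (A, B) \<longleftrightarrow> (\<forall>d\<in>K. 0 < d \<longrightarrow> (\<exists>a\<in>A. \<exists>b\<in>B. b - a < d))"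
proof (intro iffI ballI impI)
  fix d assume proper: "proper_cut K (A, B)" and d: "d \<in> K" "0 < d"
  have "\<exists>U\<in>balls K. U \<inter> A \<noteq> {} \<and> U \<inter> B \<noteq> {} \<and>
      \<not> (\<exists>s i. isLub K U s \<and> isGlb K U i \<and> s - i > d)" (is ?small)
  proof (rule ccontr)
    assume large: "\<not> ?small"
    have "improper_cut K (A, B)"
      unfolding improper_cut_def prod.case
    proof (intro bexI[of _ d] conjI ballI impI)
      fix U assume "U \<in> balls K" "U \<inter> A \<noteq> {} \<and> U \<inter> B \<noteq> {}"
      with large show "\<exists>s i. isLub K U s \<and> isGlb K U i \<and> s - i > d" by metis
    qed (use d in auto)
    with proper show False by simp
  qed
  then obtain U where U: "U \<in> balls K" "U \<inter> A \<noteq> {}" "U \<inter> B \<noteq> {}"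
      "\<And>s i. isLub K U s \<Longrightarrow> isGlb K U i \<Longrightarrow> s - i \<le> d"
    by (auto simp: not_less)
  then obtain x r where xr: "U = {y \<in> K. x - r < y \<and> y < x + r}" "x \<in> K" "r \<in> K" "0 < r"
    unfolding balls_def ball_eq by blast
  have "x - r < x + r" using xr(4) by simp
  then have "(x + r) - (x - r) \<le> d"
    unfolding xr(1) by (intro isLub_interval isGlb_interval U(4)[unfolded xr(1)] add_closed diff_closed xr)
  moreover obtain a b where "a \<in> A" "b \<in> B" "a \<in> U" "b \<in> U" using U by blast
  ultimately show "\<exists>a\<in>A. \<exists>b\<in>B. b - a < d"
    unfolding xr(1) by (intro bexI[of _ a] bexI[of _ b]) auto
next
  assume close: "\<forall>d\<in>K. 0 < d \<longrightarrow> (\<exists>a\<in>A. \<exists>b\<in>B. b - a < d)"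
  show "proper_cut K (A, B)"
  proof
    assume "improper_cut K (A, B)"
    then obtain d where d: "d \<in> K" "0 < d" and
        large: "\<forall>U\<in>balls K. U \<inter> A \<noteq> {} \<and> U \<inter> B \<noteq> {} \<longrightarrow>
          (\<exists>s i. isLub K U s \<and> isGlb K U i \<and> s - i > d)"
      unfolding improper_cut_def prod.case by (elim bexE conjE) (rule that)
    obtain a b where ab: "a \<in> A" "b \<in> B" "b - a < d" using close d by blast
    with assms have abK: "a \<in> K" "b \<in> K" "a < b" by auto
    \<comment> \<open>The ball of radius \<open>d / 2\<close> around the midpoint contains
      \<open>a\<close> and \<open>b\<close> since \<open>b - a < d\<close>, but its diameter equals
      \<open>d\<close> and so does not exceed it.\<close>
    define x where "x = (a + b) / 2"
    define V where "V = {y \<in> K. x - d / 2 < y \<and> y < x + d / 2}"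
    have K: "x \<in> K" "d / 2 \<in> K" "0 < d / 2" using abK d by (auto simp: x_def)
    have "V \<in> balls K" using K unfolding V_def balls_def ball_eq by blast
    moreover have "a \<in> V" "b \<in> V" using ab abK by (auto simp: V_def x_def field_simps)
    ultimately obtain s i where si: "isLub K V s" "isGlb K V i" "s - i > d"
      using large[rule_format, of V] ab by blast
    have lt: "x - d / 2 < x + d / 2" using K(3) by simp
    have "s \<le> x + d / 2" "x - d / 2 \<le> i"
      using si isLub_interval[OF _ _ lt] isGlb_interval[OF _ _ lt] K
      unfolding V_def isLub_iff isGlb_iff by auto
    then have "s - i \<le> (x + d / 2) - (x - d / 2)" by (rule diff_mono)
    also have "\<dots> = d" by simp
    finally show False using si(3) by simp
  qed
qed

section \<open>Order properties, signs and opposites of cuts\<close>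

context
  fixes A B
  assumes cut: "(A, B) \<in> dedekind_cuts K"
begin

lemma cut_subset: "A \<subseteq> K" "B \<subseteq> K"
  using cut by (auto simp: dedekind_cuts_def)

lemma cut_less: "a \<in> A \<Longrightarrow> b \<in> B \<Longrightarrow> a < b"
  using cut by (auto simp: dedekind_cuts_def)

text \<open>A missing \<open>q\<close> separates \<open>A\<close> from \<open>B\<close>, and no
  other element of \<open>K\<close> is missing, so each one is assigned to a side by comparison with
  \<open>q\<close>.\<close>

lemma cut_gap:
  assumes "q \<in> K" "q \<notin> A" "q \<notin> B"
  shows "A = {p \<in> K. p < q}" "B = {p \<in> K. q < p}"
proof -
  have q: "a < q" if "a \<in> A" for a using cut assms that by (auto simp: dedekind_cuts_def)
  have q': "q < b" if "b \<in> B" for b using cut assms that by (auto simp: dedekind_cuts_def)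
  have "p = q" if "p \<in> K" "p \<notin> A" "p \<notin> B" for p
    using cut assms that by (auto simp: dedekind_cuts_def)
  then show "A = {p \<in> K. p < q}" "B = {p \<in> K. q < p}"
    using q q' cut_subset by (blast dest: less_asym)+
qed

text \<open>An element of \<open>B\<close> would exceed \<open>a\<close> by \<open>cut_less\<close>,
  and a missing element would exceed \<open>a\<close> by \<open>cut_gap\<close>.\<close>

lemma cut_down_closed: "a \<in> A \<Longrightarrow> q \<in> K \<Longrightarrow> q \<le> a \<Longrightarrow> q \<in> A"
  using cut_less[of a q] cut_gap(1)[of q] by (cases "q \<in> B"; cases "q \<in> A") (auto dest: leD)

lemma cut_up_closed: "b \<in> B \<Longrightarrow> q \<in> K \<Longrightarrow> b \<le> q \<Longrightarrow> q \<in> B"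
  using cut_less[of q b] cut_gap(2)[of q] by (cases "q \<in> A"; cases "q \<in> B") (auto dest: leD)

text \<open>A maximum of \<open>A\<close> would be a supremum of \<open>A\<close> that lies in
  \<open>A\<close>.\<close>

lemma cut_no_max: "a \<in> A \<Longrightarrow> \<exists>a'\<in>A. a < a'"
proof (rule ccontr)
  assume a: "a \<in> A" "\<not> (\<exists>a'\<in>A. a < a')"
  then have "isLub K A a" using cut_subset by (auto simp: isLub_iff not_less)
  with a cut show False by (auto simp: dedekind_cuts_def)
qed

lemma cut_no_min: "b \<in> B \<Longrightarrow> \<exists>b'\<in>B. b' < b"
proof (rule ccontr)
  assume b: "b \<in> B" "\<not> (\<exists>b'\<in>B. b' < b)"
  then have "isGlb K B b" using cut_subset by (auto simp: isGlb_iff not_less)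
  with b cut show False by (auto simp: dedekind_cuts_def)
qed

text \<open>This turns the order by inclusion into a membership test at 0. When 0 lies on neither
  side, \<open>cut_gap\<close> identifies the cut with the zero cut.\<close>

lemma zero_less_cut_iff: "cut_less (cut_zero K) (A, B) \<longleftrightarrow> 0 \<in> A"
proof
  assume "0 \<in> A"
  moreover from this have "A \<noteq> {q \<in> K. q < 0}" by blast
  ultimately show "cut_less (cut_zero K) (A, B)"
    using cut_down_closed[of 0] by (auto simp: cut_less_def cut_le_def cut_zero_def)
next
  assume less: "cut_less (cut_zero K) (A, B)"
  \<comment> \<open>Inclusion alone would still permit \<open>A\<close> to be the set of negative
    elements with 0 in \<open>B\<close>; since \<open>B\<close> has no minimum, it would then also
    contain a negative element.\<close>
  have "0 \<notin> B"
  proof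
    assume "0 \<in> B"
    then obtain b where b: "b \<in> B" "b < 0" using cut_no_min by blast
    then have "b \<in> A" using less cut_subset by (auto simp: cut_less_def cut_le_def cut_zero_def)
    with b show False using cut_less by blast
  qed
  then show "0 \<in> A"
    using less cut_gap[of 0] by (auto simp: cut_less_def cut_le_def cut_zero_def)
qed

lemma cut_less_zero_iff: "cut_less (A, B) (cut_zero K) \<longleftrightarrow> 0 \<in> B"
proof
  assume "0 \<in> B"
  then show "cut_less (A, B) (cut_zero K)"
    using cut_less[of _ 0] cut_subset by (auto simp: cut_less_def cut_le_def cut_zero_def)
next
  assume less: "cut_less (A, B) (cut_zero K)"
  then have "0 \<notin> A" by (auto simp: cut_less_def cut_le_def cut_zero_def)
  then show "0 \<in> B"
    using less cut_gap[of 0] by (auto simp: cut_less_def cut_le_def cut_zero_def)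
qed

text \<open>Negation reverses the order, so the absence of a maximum of \<open>A\<close> and of a
  minimum of \<open>B\<close> trade places.\<close>

lemma cut_uminus_closed: "cut_uminus (A, B) \<in> dedekind_cuts K"
proof -
  have mem: "q \<in> uminus ` S \<longleftrightarrow> - q \<in> S" for q :: 'q and S by force
  have no_min: "i \<notin> uminus ` A" if "isGlb K (uminus ` A) i" for i
  proof
    assume "i \<in> uminus ` A"
    then obtain a where "a \<in> A" "- i < a" using cut_no_max[of "- i"] by (auto simp: mem)
    with that show False by (force simp: isGlb_iff)
  qed
  have no_max: "s \<notin> uminus ` B" if "isLub K (uminus ` B) s" for s
  proof
    assume "s \<in> uminus ` B"
    then obtain b where "b \<in> B" "b < - s" using cut_no_min[of "- s"] by (auto simp: mem)
    with that show False by (force simp: isLub_iff)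
  qed
  have unique: "p = q"
    if "p \<in> K - (uminus ` B \<union> uminus ` A)" "q \<in> K - (uminus ` B \<union> uminus ` A)" for p q
  proof -
    have "\<forall>p\<in>K - (A \<union> B). \<forall>q\<in>K - (A \<union> B). p = q" using cut by (auto simp: dedekind_cuts_def)
    moreover have "- p \<in> K - (A \<union> B)" "- q \<in> K - (A \<union> B)" using that by (auto simp: mem)
    ultimately have "- p = - q" by blast
    then show ?thesis by simp
  qed
  have gap: "b \<in> uminus ` B \<Longrightarrow> b < q" "a \<in> uminus ` A \<Longrightarrow> q < a"
    if "q \<in> K - (uminus ` B \<union> uminus ` A)" for a b q
    using that cut_gap[of "- q"] by (auto simp: mem)
  have less: "b < a" if "b \<in> uminus ` B" "a \<in> uminus ` A" for a b
    using that cut_less[of "- a" "- b"] by (auto simp: mem)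
  show ?thesis
    unfolding dedekind_cuts_def cut_uminus_def
  proof (simp only: mem_Collect_eq prod.case, intro conjI ballI allI impI)
    show "uminus ` B \<subseteq> K" "uminus ` A \<subseteq> K" using cut_subset by auto
    show "uminus ` B \<inter> uminus ` A = {}" using less by blast
  qed (erule (1) unique gap less | erule no_min no_max)+
qed

text \<open>The distances in \<open>proper_cut_iff\<close> are unchanged, because
  \<open>- a - (- b) = b - a\<close>.\<close>

lemma proper_cut_uminus_iff: "proper_cut K (cut_uminus (A, B)) \<longleftrightarrow> proper_cut K (A, B)"
proof -
  have "proper_cut K (uminus ` B, uminus ` A) \<longleftrightarrow>
      (\<forall>d\<in>K. 0 < d \<longrightarrow> (\<exists>b\<in>uminus ` B. \<exists>a\<in>uminus ` A. a - b < d))"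
    using cut_less cut_subset by (intro proper_cut_iff) auto
  also have "\<dots> \<longleftrightarrow> (\<forall>d\<in>K. 0 < d \<longrightarrow> (\<exists>a\<in>A. \<exists>b\<in>B. b - a < d))"
    by (simp, blast)
  also have "\<dots> \<longleftrightarrow> proper_cut K (A, B)"
    using cut_less cut_subset by (intro proper_cut_iff[symmetric]) auto
  finally show ?thesis by (simp add: cut_uminus_def)
qed

end

text \<open>Outside \<open>C\<close>, only its supremum, if there is one, is left out. This makes
  the missing element unique and keeps a minimum out of the upper side.\<close>

lemma lower_set_cut:
  assumes C: "C \<subseteq> K" "\<And>c q. c \<in> C \<Longrightarrow> q \<in> K \<Longrightarrow> q \<le> c \<Longrightarrow> q \<in> C"
    "\<And>c. c \<in> C \<Longrightarrow> \<exists>c'\<in>C. c < c'"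
  shows "(C, K - (C \<union> {s. isLub K C s})) \<in> dedekind_cuts K"
proof -
  define D where "D = K - (C \<union> {s. isLub K C s})"
  have above: "c < q" if "c \<in> C" "q \<in> K" "q \<notin> C" for c q
    using that C(2)[of c q] by (meson not_le)
  have no_min: "i \<notin> D" if i: "isGlb K D i" for i
  proof
    assume iD: "i \<in> D"
    then have "\<not> isLub K C i" "i \<in> K" "\<forall>c\<in>C. c \<le> i"
      using above by (auto simp: D_def intro: less_imp_le)
    then obtain u where u: "u \<in> K" "\<forall>c\<in>C. c \<le> u" "u < i"
      by (auto simp: isLub_iff not_le)
    \<comment> \<open>The bound \<open>u\<close> may itself be the supremum of \<open>C\<close> and
      hence be absent from \<open>D\<close>; a point strictly between \<open>u\<close> and
      \<open>i\<close> certainly lies in \<open>D\<close>.\<close>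
    then obtain z where z: "z \<in> K" "u < z" "z < i" using dense[of u i] iD by (auto simp: D_def)
    then have "z \<in> D" using u by (force simp: D_def isLub_iff)
    with i z show False by (auto simp: isGlb_iff)
  qed
  have gap: "isLub K C q" if "q \<in> K - (C \<union> D)" for q using that by (auto simp: D_def)
  have unique: "p = q" if "p \<in> K - (C \<union> D)" "q \<in> K - (C \<union> D)" for p q
    using gap[OF that(1)] gap[OF that(2)] by (auto simp: isLub_iff intro: antisym)
  have less_D: "q < d" if "q \<in> K - (C \<union> D)" "d \<in> D" for q d
  proof -
    have "q \<le> d" using gap[OF that(1)] that(2) above by (auto simp: isLub_iff D_def less_imp_le)
    with that show ?thesis by (cases "q = d") auto
  qed
  have "(C, D) \<in> dedekind_cuts K"
    unfolding dedekind_cuts_def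
  proof (clarify, intro conjI)
    show "C \<subseteq> K" "D \<subseteq> K" "C \<inter> D = {}" using C(1) by (auto simp: D_def)
    show "\<forall>s. isLub K C s \<longrightarrow> s \<notin> C" using C(3) by (force simp: isLub_iff)
    show "\<forall>a\<in>C. \<forall>b\<in>D. a < b" using above by (auto simp: D_def)
  qed (use no_min unique less_D above in auto)
  then show ?thesis by (simp add: D_def)
qed

section \<open>Inverses of positive proper cuts\<close>

context
  fixes A B
  assumes cut: "(A, B) \<in> dedekind_cuts K"
    and proper: "proper_cut K (A, B)"
    and pos: "0 \<in> A"
begin

lemma pos_cut_upper: "b \<in> B \<Longrightarrow> 0 < b"
  using cut_less[OF cut pos] .

text \<open>The positive bound \<open>a0\<close> does not depend on \<open>d\<close>. Replacing
  \<open>a\<close> by \<open>max a a0\<close> stays in \<open>A\<close> and can only shrink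
  \<open>b - a\<close>.\<close>

lemma pos_cut_close:
  obtains a0 where "a0 \<in> A" "0 < a0"
    "\<And>d. d \<in> K \<Longrightarrow> 0 < d \<Longrightarrow> \<exists>a\<in>A. \<exists>b\<in>B. a0 \<le> a \<and> b - a < d"
proof -
  obtain a0 where a0: "a0 \<in> A" "0 < a0" using cut_no_max[OF cut pos] by blast
  show ?thesis
  proof (rule that[OF a0])
    fix d assume d: "d \<in> K" "0 < d"
    then obtain a b where ab: "a \<in> A" "b \<in> B" "b - a < d"
      using proper proper_cut_iff[OF cut_subset[OF cut] cut_less[OF cut]] by blast
    have "max a a0 \<in> A" using ab a0 by (auto simp: max_def)
    moreover have "b - max a a0 < d"
      using ab(3) by (rule le_less_trans[rotated]) simp
    ultimately show "\<exists>a\<in>A. \<exists>b\<in>B. a0 \<le> a \<and> b - a < d" using ab(2) by (metis max.cobounded2)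
  qed
qed

text \<open>The multiplicative form of properness: closeness with tolerance
  \<open>(r - 1) * a0\<close> suffices, since this is at most \<open>(r - 1) * a\<close>.\<close>

lemma pos_cut_ratio:
  assumes "r \<in> K" "1 < r"
  obtains a b where "a \<in> A" "b \<in> B" "0 < a" "b < r * a"
proof -
  obtain a0 where a0: "a0 \<in> A" "0 < a0"
      "\<And>d. d \<in> K \<Longrightarrow> 0 < d \<Longrightarrow> \<exists>a\<in>A. \<exists>b\<in>B. a0 \<le> a \<and> b - a < d"
    using pos_cut_close by blast
  have "(r - 1) * a0 \<in> K" "0 < (r - 1) * a0" using a0 assms cut_subset[OF cut] by auto
  then obtain a b where ab: "a \<in> A" "b \<in> B" "a0 \<le> a" "b - a < (r - 1) * a0" using a0(3) by blast
  have "(r - 1) * a0 \<le> (r - 1) * a" using ab(3) assms(2) by (intro mult_left_mono) auto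
  with ab(4) have "b - a < (r - 1) * a" by (rule less_le_trans)
  then have "b < r * a" by (simp add: algebra_simps)
  with ab a0 show ?thesis by (intro that[of a b]) auto
qed

text \<open>Reciprocals of positive elements of \<open>A\<close> avoid the supremum removed from
  \<open>D\<close>: a larger \<open>a'\<close> in \<open>A\<close> makes \<open>1 / a'\<close> a
  smaller upper bound of \<open>C\<close> than \<open>1 / a\<close>.\<close>

lemma cut_inverse_posE:
  obtains C D where "cut_inverse_pos K (A, B) = (C, D)" "(C, D) \<in> dedekind_cuts K"
    "\<And>q. q \<in> C \<longleftrightarrow> q \<in> K \<and> (q \<le> 0 \<or> 1 / q \<in> B)"
    "\<And>a. a \<in> A \<Longrightarrow> 0 < a \<Longrightarrow> 1 / a \<in> D"
proof -
  define C where "C = {1 / y | y. y \<in> B} \<union> {q \<in> K. q \<le> 0}"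
  define D where "D = K - (C \<union> {s. isLub K C s})"
  have BK: "B \<subseteq> K" and AK: "A \<subseteq> K" using cut_subset[OF cut] by auto
  have C: "q \<in> C \<longleftrightarrow> q \<in> K \<and> (q \<le> 0 \<or> 1 / q \<in> B)" for q
  proof -
    \<comment> \<open>Taking reciprocals is an involution, even at 0, because
      \<open>1 / 0 = 0\<close>.\<close>
    have "q \<in> {1 / y | y. y \<in> B} \<longleftrightarrow> 1 / q \<in> B"
      by (auto intro!: exI[of _ "1 / q"])
    moreover have "1 / q \<in> B \<Longrightarrow> q \<in> K"
      using BK divide_closed[of 1 "1 / q"] by auto
    ultimately show ?thesis by (auto simp: C_def)
  qed
  have down: "q \<in> C" if "c \<in> C" "q \<in> K" "q \<le> c" for c q
  proof (cases "q \<le> 0")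
    case False
    with that have "1 / c \<in> B" "1 / c \<le> 1 / q" by (auto simp: C frac_le)
    then have "1 / q \<in> B" using cut_up_closed[OF cut, of "1 / c" "1 / q"] that by simp
    with that show ?thesis by (simp add: C)
  qed (use that in \<open>simp add: C\<close>)
  have recip: "1 / b \<in> C" if "b \<in> B" for b using that by (auto simp: C_def)
  have no_max: "\<exists>c'\<in>C. c < c'" if c: "c \<in> C" for c
  proof (cases "c \<le> 0")
    case True
    \<comment> \<open>The ratio 2 is arbitrary; the point is that properness makes \<open>B\<close>
      nonempty.\<close>
    obtain a b where "b \<in> B" using pos_cut_ratio[of 2] by auto
    moreover from this have "c < 1 / b" using True pos_cut_upper
      by (meson le_less_trans zero_less_divide_1_iff)
    ultimately show ?thesis using recip by blast
  next
    case False
    then have "1 / c \<in> B" using c by (simp add: C)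
    then obtain b where b: "b \<in> B" "b < 1 / c" using cut_no_min[OF cut] by blast
    then have "c < 1 / b" using False pos_cut_upper[of b] by (simp add: field_simps)
    with b show ?thesis using recip by blast
  qed
  have "1 / a \<in> D" if a: "a \<in> A" "0 < a" for a
  proof -
    have "1 / a \<notin> C" using a cut_less[OF cut, of a a] by (auto simp: C)
    moreover have "\<not> isLub K C (1 / a)"
    proof
      assume lub: "isLub K C (1 / a)"
      obtain a' where a': "a' \<in> A" "a < a'" using cut_no_max[OF cut a(1)] by blast
      have "c \<le> 1 / a'" if "c \<in> C" for c
      proof (cases "c \<le> 0")
        case True
        moreover have "0 \<le> 1 / a'" using a a' by auto
        ultimately show ?thesis by (rule order_trans)
      next
        case False
        then have "1 / c \<in> B" using that by (simp add: C)
        then have "a' < 1 / c" using a' cut_less[OF cut] by blast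
        then show ?thesis using False a a' by (simp add: field_simps)
      qed
      then have "1 / a \<le> 1 / a'" using lub a' AK by (auto simp: isLub_iff)
      with a a' show False by (simp add: field_simps)
    qed
    ultimately show ?thesis using a AK by (auto simp: D_def)
  qed
  moreover have "(C, D) \<in> dedekind_cuts K"
    unfolding D_def
  proof (rule lower_set_cut)
    show "C \<subseteq> K" by (auto simp: C)
  qed (fact down no_max)+
  moreover have "cut_inverse_pos K (A, B) = (C, D)"
    by (simp add: cut_inverse_pos_def C_def D_def Let_def)
  ultimately show ?thesis using C that by blast
qed

lemma cut_inverse_pos_closed: "cut_inverse_pos K (A, B) \<in> dedekind_cuts K"
  using cut_inverse_posE by metis

lemma zero_in_cut_inverse_pos: "0 \<in> fst (cut_inverse_pos K (A, B))"
  by (simp add: cut_inverse_pos_def Let_def)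

lemma proper_cut_inverse_pos: "proper_cut K (cut_inverse_pos K (A, B))"
proof -
  obtain C D where CD: "cut_inverse_pos K (A, B) = (C, D)" "(C, D) \<in> dedekind_cuts K"
    "\<And>q. q \<in> C \<longleftrightarrow> q \<in> K \<and> (q \<le> 0 \<or> 1 / q \<in> B)"
    "\<And>a. a \<in> A \<Longrightarrow> 0 < a \<Longrightarrow> 1 / a \<in> D"
    by (rule cut_inverse_posE) blast
  obtain a0 where a0: "a0 \<in> A" "0 < a0"
      "\<And>d. d \<in> K \<Longrightarrow> 0 < d \<Longrightarrow> \<exists>a\<in>A. \<exists>b\<in>B. a0 \<le> a \<and> b - a < d"
    using pos_cut_close by blast
  have "\<exists>c\<in>C. \<exists>e\<in>D. e - c < d" if d: "d \<in> K" "0 < d" for d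
  proof -
    \<comment> \<open>This tolerance becomes at most \<open>d\<close> after division by
      \<open>a * b\<close>, which is at least \<open>a0 * a0\<close>.\<close>
    have "d * (a0 * a0) \<in> K" "0 < d * (a0 * a0)" using a0 d cut_subset[OF cut] by auto
    then obtain a b where ab: "a \<in> A" "b \<in> B" "a0 \<le> a" "b - a < d * (a0 * a0)"
      using a0(3) by blast
    have le: "a0 \<le> b" "0 < a" "0 < b"
      using ab a0 cut_less[OF cut, of a b] by auto
    have "a0 * a0 \<le> a * b" using ab le a0 by (intro mult_mono) auto
    then have "d * (a0 * a0) \<le> d * (a * b)" using d by simp
    then have "b - a < d * (a * b)" using ab(4) by simp
    then have "1 / a - 1 / b < d" using le by (simp add: field_simps)
    moreover have "1 / b \<in> C" using ab cut_subset[OF cut] by (auto simp: CD(3))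
    moreover have "1 / a \<in> D" using ab le by (intro CD(4))
    ultimately show ?thesis by blast
  qed
  then show ?thesis
    unfolding CD(1) using proper_cut_iff[OF cut_subset[OF CD(2)] cut_less[OF CD(2)]] by blast
qed

text \<open>Products fall on the correct side of 1 because the sides of each cut are separated.
  Conversely, \<open>q\<close> is factored as \<open>a * (q / a)\<close> below 1 and as
  \<open>b * (q / b)\<close> above 1, with \<open>a\<close> and \<open>b\<close> taken from
  \<open>pos_cut_ratio\<close>.\<close>

lemma cut_mult_nonneg_inverse_pos:
  "cut_mult_nonneg K (A, B) (cut_inverse_pos K (A, B)) = cut_one K"
proof -
  obtain C D where CD: "cut_inverse_pos K (A, B) = (C, D)" "(C, D) \<in> dedekind_cuts K"
    "\<And>q. q \<in> C \<longleftrightarrow> q \<in> K \<and> (q \<le> 0 \<or> 1 / q \<in> B)"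
    "\<And>a. a \<in> A \<Longrightarrow> 0 < a \<Longrightarrow> 1 / a \<in> D"
    by (rule cut_inverse_posE) blast
  note AB = cut_subset[OF cut] cut_less[OF cut]
  note CDK = cut_subset[OF CD(2)] cut_less[OF CD(2)]
  have "{q \<in> K. q < 0} \<union> {x * y | x y. x \<in> A \<and> y \<in> C \<and> 0 \<le> x \<and> 0 \<le> y} = {q \<in> K. q < 1}"
    (is "?L = _")
  proof (intro subset_antisym subsetI)
    fix q assume q: "q \<in> ?L"
    show "q \<in> {q \<in> K. q < 1}"
    proof (cases "q \<in> {q \<in> K. q < 0}")
      case True
      then show ?thesis by (auto intro: less_trans[OF _ zero_less_one])
    next
      case False
      then obtain x y where xy: "q = x * y" "x \<in> A" "y \<in> C" "0 \<le> x" "0 \<le> y" using q by auto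
      have "x * y < 1"
      \<comment> \<open>The element 0 belongs to \<open>C\<close> without being the reciprocal of an
        element of \<open>B\<close>.\<close>
      proof (cases "y = 0")
        case False
        with xy have "1 / y \<in> B" "0 < y" by (auto simp: CD(3))
        then have "x < 1 / y" using AB(3) xy by blast
        then show ?thesis using \<open>0 < y\<close> by (simp add: field_simps)
      qed simp
      then show ?thesis using xy AB(1) CDK(1) by (auto intro: mult_closed)
    qed
  next
    fix q assume "q \<in> {q \<in> K. q < 1}"
    then have q: "q \<in> K" "q < 1" by auto
    consider "q < 0" | "q = 0" | "0 < q" by fastforce
    then show "q \<in> ?L"
    proof cases
      case 2
      then show ?thesis using pos CD(3)[of 0] by auto
    next
      case 3
      \<comment> \<open>The ratio \<open>1 / q\<close> exceeds 1; the resulting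
        \<open>b < a / q\<close> says that \<open>q / a < 1 / b\<close>, which puts
        \<open>q / a\<close> into \<open>C\<close>.\<close>
      obtain a b where ab: "a \<in> A" "b \<in> B" "0 < a" "b < (1 / q) * a"
        using pos_cut_ratio[of "1 / q"] q 3 by auto
      have b: "0 < b" using pos_cut_upper ab by blast
      have "q / a \<in> C"
      proof (rule cut_down_closed[OF CD(2)])
        show "1 / b \<in> C" using ab AB(2) by (auto simp: CD(3))
        show "q / a \<in> K" using q ab AB(1,2) by auto
        show "q / a \<le> 1 / b" using ab b 3 by (simp add: field_simps)
      qed
      moreover have "q = a * (q / a)" "0 \<le> q / a" using ab 3 by auto
      ultimately show ?thesis using ab by (blast intro: less_imp_le)
    qed (use q in auto)
  qed
  moreover have "{x * y | x y. x \<in> B \<and> y \<in> D} = {q \<in> K. q > 1}" (is "?R = _")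
  proof (intro subset_antisym subsetI)
    fix q assume "q \<in> ?R"
    then obtain b e where be: "q = b * e" "b \<in> B" "e \<in> D" by blast
    have "1 / b \<in> C" using be AB(2) by (auto simp: CD(3))
    then have "1 / b < e" using be CDK(3) by blast
    then have "1 < b * e" using pos_cut_upper[OF be(2)] by (simp add: field_simps)
    then show "q \<in> {q \<in> K. q > 1}" using be AB(2) CDK(2) by (auto intro: mult_closed)
  next
    fix q assume "q \<in> {q \<in> K. q > 1}"
    then have q: "q \<in> K" "1 < q" by auto
    obtain a b where ab: "a \<in> A" "b \<in> B" "0 < a" "b < q * a"
      using pos_cut_ratio q by blast
    have b: "0 < b" using pos_cut_upper ab by blast
    have "q / b \<in> D"
    proof (rule cut_up_closed[OF CD(2)])
      show "1 / a \<in> D" using ab by (intro CD(4))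
      show "q / b \<in> K" using q ab AB(1,2) by auto
      show "1 / a \<le> q / b" using ab b by (simp add: field_simps)
    qed
    moreover have "q = b * (q / b)" using b by auto
    ultimately show "q \<in> ?R" using ab by blast
  qed
  ultimately show ?thesis by (simp add: CD(1) cut_mult_nonneg_def cut_one_def)
qed

end

section \<open>Nonzero proper cuts of either sign\<close>

lemma cut_uminus_uminus: "cut_uminus (cut_uminus x) = (x :: 'q set \<times> 'q set)"
  by (cases x) (simp add: cut_uminus_def image_image)

theorem cut_inverse_correct:
  assumes cut: "(A, B) \<in> dedekind_cuts K"
    and proper: "proper_cut K (A, B)"
    and nz: "(A, B) \<noteq> cut_zero K"
  shows "cut_inverse K (A, B) \<in> dedekind_cuts K \<and> proper_cut K (cut_inverse K (A, B)) \<and>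
    cut_mult K (A, B) (cut_inverse K (A, B)) = cut_one K"
proof -
  note sgn = zero_less_cut_iff cut_less_zero_iff
  have disj: "0 \<in> S \<Longrightarrow> 0 \<notin> T" if "(S, T) \<in> dedekind_cuts K" for S T
    using cut_less[OF that, of 0 0] by auto
  \<comment> \<open>If 0 were missing, \<open>cut_gap\<close> would give the zero cut.\<close>
  consider "0 \<in> A" | "0 \<in> B"
    using nz cut_gap[OF cut, of 0] by (auto simp: cut_zero_def)
  then show ?thesis
  proof cases
    case 1
    note hyps = cut proper 1
    obtain C D where CD: "cut_inverse_pos K (A, B) = (C, D)" by fastforce
    have inv: "(C, D) \<in> dedekind_cuts K" "0 \<in> C"
      using cut_inverse_pos_closed[OF hyps] zero_in_cut_inverse_pos[OF hyps] CD by auto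
    have "cut_inverse K (A, B) = (C, D)"
      by (simp add: cut_inverse_def sgn[OF cut] 1 CD)
    moreover have "cut_mult K (A, B) (C, D) = cut_mult_nonneg K (A, B) (C, D)"
      using 1 inv(2) disj[OF cut] disj[OF inv(1)]
      by (simp add: cut_mult_def cut_abs_def sgn[OF cut] sgn[OF inv(1)])
    ultimately show ?thesis
      using inv proper_cut_inverse_pos[OF hyps] cut_mult_nonneg_inverse_pos[OF hyps] CD by simp
  next
    case 2
    obtain A' B' where neg: "cut_uminus (A, B) = (A', B')" by fastforce
    have cut': "(A', B') \<in> dedekind_cuts K" using cut_uminus_closed[OF cut] neg by simp
    have proper': "proper_cut K (A', B')"
      using proper proper_cut_uminus_iff[OF cut] neg by simp
    have pos': "0 \<in> A'" using neg 2 by (force simp: cut_uminus_def)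
    note hyps = cut' proper' pos'
    obtain C D where CD: "cut_inverse_pos K (A', B') = (C, D)" by fastforce
    have inv: "(C, D) \<in> dedekind_cuts K" "0 \<in> C"
      using cut_inverse_pos_closed[OF hyps] zero_in_cut_inverse_pos[OF hyps] CD by auto
    obtain C' D' where neg': "cut_uminus (C, D) = (C', D')" by fastforce
    have inv': "(C', D') \<in> dedekind_cuts K" using cut_uminus_closed[OF inv(1)] neg' by simp
    have D': "0 \<in> D'" using neg' inv(2) by (force simp: cut_uminus_def)
    have neg'': "cut_uminus (C', D') = (C, D)" using cut_uminus_uminus[of "(C, D)"] neg' by simp
    \<comment> \<open>Both the cut and its inverse are negative, so \<open>cut_mult\<close> takes
      the branch of equal signs, and the absolute values return to \<open>(A', B')\<close> and
      \<open>(C, D)\<close>.\<close>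
    have "0 \<notin> A" "0 \<notin> C'" using 2 D' disj[OF cut] disj[OF inv'] by auto
    then have "cut_inverse K (A, B) = (C', D')"
      and "cut_mult K (A, B) (C', D') = cut_mult_nonneg K (A', B') (C, D)"
      by (simp_all add: cut_inverse_def cut_mult_def cut_abs_def sgn[OF cut] sgn[OF inv'] 2 D'
          neg CD neg' neg'')
    moreover have "proper_cut K (C', D')"
      using proper_cut_inverse_pos[OF hyps] proper_cut_uminus_iff[OF inv(1)] CD neg' by simp
    ultimately show ?thesis
      using inv' cut_mult_nonneg_inverse_pos[OF hyps] CD by simp
  qed
qed

end

section \<open>Closure of the ordinal rationals under the field operations\<close>

lemma zero_in_ord_Nats: "0 \<in> ord_Nats \<alpha>"
  by (simp add: ord_Nats_def less_omega_exp_iff)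

text \<open>The only exponent of 1 is 0, which lies below \<open>omega_exp \<alpha>\<close> even for
  the least \<open>\<alpha>\<close>.\<close>

lemma one_in_ord_Nats: "1 \<in> ord_Nats \<alpha>"
  by (simp add: ord_Nats_def less_omega_exp_iff omega_exp_zero[symmetric] cnf_coeff_omega_exp)

lemma ord_diff_in_ord_Ints:
  "a \<in> ord_Nats \<alpha> \<Longrightarrow> b \<in> ord_Nats \<alpha> \<Longrightarrow> ord_diff a b \<in> ord_Ints \<alpha>"
  by (auto simp: ord_Ints_def)

lemma ord_IntsE:
  assumes "x \<in> ord_Ints \<alpha>"
  obtains a b where "x = ord_diff a b" "a \<in> ord_Nats \<alpha>" "b \<in> ord_Nats \<alpha>"
  using assms by (auto simp: ord_Ints_def)

lemma zero_in_ord_Ints: "0 \<in> ord_Ints \<alpha>"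
  unfolding ord_diff_arith(1) by (intro ord_diff_in_ord_Ints zero_in_ord_Nats)

lemma one_in_ord_Ints: "1 \<in> ord_Ints \<alpha>"
  unfolding ord_diff_arith(2) by (intro ord_diff_in_ord_Ints zero_in_ord_Nats one_in_ord_Nats)

lemma ord_Ints_add: "x \<in> ord_Ints \<alpha> \<Longrightarrow> y \<in> ord_Ints \<alpha> \<Longrightarrow> x + y \<in> ord_Ints \<alpha>"
  by (elim ord_IntsE) (simp add: ord_diff_arith(3) ord_diff_in_ord_Ints ord_Nats_add)

lemma ord_Ints_uminus: "x \<in> ord_Ints \<alpha> \<Longrightarrow> - x \<in> ord_Ints \<alpha>"
  by (elim ord_IntsE) (simp add: ord_diff_arith(4) ord_diff_in_ord_Ints)

lemma ord_Ints_mult: "x \<in> ord_Ints \<alpha> \<Longrightarrow> y \<in> ord_Ints \<alpha> \<Longrightarrow> x * y \<in> ord_Ints \<alpha>"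
  by (elim ord_IntsE) (simp add: ord_diff_arith(5) ord_diff_in_ord_Ints ord_Nats_add ord_Nats_mult)

lemma Fract_in_ord_Rats:
  "a \<in> ord_Ints \<alpha> \<Longrightarrow> b \<in> ord_Ints \<alpha> \<Longrightarrow> b \<noteq> 0 \<Longrightarrow> Fract a b \<in> ord_Rats \<alpha>"
  by (auto simp: ord_Rats_def)

text \<open>Sums and products have the denominator \<open>b * d\<close>, which is nonzero in the
  integral domain \<open>ord_int\<close> and stays in \<open>ord_Ints \<alpha>\<close>.\<close>

lemma ord_Rats_subfield: "ordered_subfield (ord_Rats \<alpha>)"
proof
  show "0 \<in> ord_Rats \<alpha>" "1 \<in> ord_Rats \<alpha>"
    by (simp_all add: Zero_fract_def One_fract_def Fract_in_ord_Rats zero_in_ord_Ints one_in_ord_Ints)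
  then have zero: "0 \<in> ord_Rats \<alpha>" by simp
  fix x y assume "x \<in> ord_Rats \<alpha>"
  then obtain a b where x: "x = Fract a b" "a \<in> ord_Ints \<alpha>" "b \<in> ord_Ints \<alpha>" "b \<noteq> 0"
    by (auto simp: ord_Rats_def)
  show "- x \<in> ord_Rats \<alpha>" using x by (simp add: Fract_in_ord_Rats ord_Ints_uminus)
  show "inverse x \<in> ord_Rats \<alpha>"
  \<comment> \<open>Swapping numerator and denominator needs \<open>a \<noteq> 0\<close>; otherwise
    the inverse is 0 by convention.\<close>
  proof (cases "a = 0")
    case True
    then have "x = 0" using x(1) by (simp add: Zero_fract_def eq_fract)
    then show ?thesis using zero by simp
  qed (use x in \<open>simp add: Fract_in_ord_Rats\<close>)
  assume "y \<in> ord_Rats \<alpha>"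
  then obtain c d where y: "y = Fract c d" "c \<in> ord_Ints \<alpha>" "d \<in> ord_Ints \<alpha>" "d \<noteq> 0"
    by (auto simp: ord_Rats_def)
  show "x + y \<in> ord_Rats \<alpha>" "x * y \<in> ord_Rats \<alpha>"
    using x y by (simp_all add: Fract_in_ord_Rats ord_Ints_add ord_Ints_mult)
qed

text \<open>The type \<open>'b ordinal\<close> supplies both \<open>\<alpha>\<close> and the
  innermost exponents. Those occurring in \<open>ord_Nats \<alpha>\<close> lie below
  \<open>\<alpha>\<close>, so larger elements of the type do not affect it.\<close>

theorem mainTheorem9:
  fixes \<alpha> :: "'b ordinal"
    and A B :: "'b ordinal ord_rat set"
  assumes "(A, B) \<in> dedekind_cuts (ord_Rats \<alpha>)"
    and "proper_cut (ord_Rats \<alpha>) (A, B)"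
    and "(A, B) \<noteq> cut_zero (ord_Rats \<alpha>)"
  shows "cut_inverse (ord_Rats \<alpha>) (A, B) \<in> dedekind_cuts (ord_Rats \<alpha>) \<and>
    proper_cut (ord_Rats \<alpha>) (cut_inverse (ord_Rats \<alpha>) (A, B)) \<and>
    cut_mult (ord_Rats \<alpha>) (A, B) (cut_inverse (ord_Rats \<alpha>) (A, B)) = cut_one (ord_Rats \<alpha>)"
  by (rule ordered_subfield.cut_inverse_correct[OF ord_Rats_subfield assms])

end
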